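(* Let $X$ be a real normed space, let $\mathcal F$ be a directionally fine family of closed cones in $X$, and let $L,K\subset X$ be locally compact cones such that $L\cap K=\{0_X\}$. Set $d:=d(B_L,B_K)$; then $d>0$. For every $0<\varepsilon<\min\{1,d/4\}$, there exist closed cones $D_L^\varepsilon,D_K^\varepsilon$, each a finite union of members of $\mathcal F$, such that \[ L\setminus\{0_X\}\subset\operatorname{int}D_L^\varepsilon,\qquad K\setminus\{0_X\}\subset\operatorname{int}D_K^\varepsilon,\qquad D_L^\varepsilon\cap D_K^\varepsilon=\{0_X\}, \] with $L\subset D_L^\varepsilon\subset L_\varepsilon$ and $K\subset D_K^\varepsilon\subset K_\varepsilon$. Moreover, $D_L^\varepsilon\cap S_X\subset\{x\in S_X:d(x,B_L)\le2\varepsilon\}$ and $D_K^\varepsilon\cap S_X\subset\{x\in S_X:d(x,B_K)\le2\varepsilon\}$. In addition, there exist a continuous positively homogeneous function $\Phi:X\to\mathbb R$ and constants $\gamma_L,\gamma_K>0$ such that $|\Phi(x)|\le\|x\|$ for every $x\in X$ and \[ \Phi(l)\ge\gamma_L\|l\|,\qquad \Phi(k)\le-\gamma_K\|k\|,\qquad\forall l\in L,\ \forall k\in K. \]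
   Context: $S_X$, $B_X$ are the unit sphere and closed unit ball, $B(x,r)=x+rB_X$, $\operatorname{cone}(A)=\{ta:t\ge0,\ a\in A\}$, $d(x,A)=\inf_{a\in A}\|x-a\|$, $d(A,B)=\inf_{a\in A}d(a,B)$. A nonempty set $C\subset X$ is a cone if $tC\subset C$ for every $t\ge 0$; all cones are assumed proper, i.e. $\{0_X\}\subsetneq C\subsetneq X$ (not necessarily convex). A family $\mathcal F$ of closed cones in $X$ is directionally fine if for every $u\in S_X$ and $\varepsilon\in(0,1)$ there exists $C\in\mathcal F$ with $u\in\operatorname{int}C\subset C\subset\operatorname{cone}B(u,\varepsilon)$. A cone $L$ is locally compact if for every $x\in L$ there is $r>0$ with $L\cap B(x,r)$ norm compact. For a cone $L$, $B_L:=L\cap S_X$ is its norm-base and $L_\varepsilon:=\operatorname{cone}(B_L+\varepsilon B_X)$. A mapping is positively homogeneous if $\Phi(tx)=t\Phi(x)$ for all $t\ge0$, $x\in X$. *)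

theory Defs
  imports "HOL-Analysis.Analysis"
begin

definition cone_gen :: "'a::real_normed_vector set \<Rightarrow> 'a set" where
  "cone_gen A = {t *\<^sub>R a | t a. 0 \<le> t \<and> a \<in> A}"

definition proper_cone :: "'a::real_normed_vector set \<Rightarrow> bool" where
  "proper_cone C \<longleftrightarrow> cone C \<and> {0} \<subset> C \<and> C \<subset> UNIV"

definition directionally_fine :: "'a::real_normed_vector set set \<Rightarrow> bool" where
  "directionally_fine F \<longleftrightarrow>
     (\<forall>C\<in>F. proper_cone C \<and> closed C) \<and>
     (\<forall>u\<in>sphere 0 1. \<forall>\<epsilon>\<in>{0<..<1}. \<exists>C\<in>F.
        u \<in> interior C \<and> interior C \<subseteq> C \<and> C \<subseteq> cone_gen (cball u \<epsilon>))"

definition locally_compact_cone :: "'a::real_normed_vector set \<Rightarrow> bool" where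
  "locally_compact_cone L \<longleftrightarrow>
     proper_cone L \<and> (\<forall>x\<in>L. \<exists>r>0. compact (L \<inter> cball x r))"

definition norm_base :: "'a::real_normed_vector set \<Rightarrow> 'a set" where
  "norm_base L = L \<inter> sphere 0 1"

definition cone_enlargement :: "'a::real_normed_vector set \<Rightarrow> real \<Rightarrow> 'a set" where
  "cone_enlargement L \<epsilon> =
     cone_gen {b + \<epsilon> *\<^sub>R y | b y. b \<in> norm_base L \<and> y \<in> cball 0 1}"

definition positively_homogeneous :: "('a::real_normed_vector \<Rightarrow> real) \<Rightarrow> bool" where
  "positively_homogeneous \<Phi> \<longleftrightarrow> (\<forall>t\<ge>0. \<forall>x. \<Phi> (t *\<^sub>R x) = t * \<Phi> x)"

definition finite_union_of_members :: "'a set set \<Rightarrow> 'a set \<Rightarrow> bool" where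
  "finite_union_of_members F D \<longleftrightarrow> (\<exists>G. finite G \<and> G \<subseteq> F \<and> D = \<Union>G)"

end

theory Submission
  imports Defs
begin

text \<open>
  Local compactness of a cone at the origin makes its norm-base compact. Cover the norm-base of
  \<open>L\<close> by the interiors of finitely many members of the family, each inside \<open>cone B(u,\<epsilon>)\<close> for a
  base point \<open>u\<close>. Normalising moves a point of \<open>B(u,\<epsilon>)\<close> by at most \<open>\<epsilon>\<close>, so
  every unit vector of the union is within \<open>2\<epsilon>\<close> of the base, and a common unit vector of the two
  unions would force \<open>d \<le> 4\<epsilon>\<close>. The separating function is
  \<open>\<Phi> x = d(x,K) - d(x,L)\<close>, with \<open>\<gamma>\<^sub>L = \<gamma>\<^sub>K = d/2\<close>.
\<close>

text \<open>Radial projection moves \<open>x\<close> by \<open>\<bar>1 - norm x\<bar>\<close>, and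
  since \<open>norm u = 1\<close> this is at most \<open>norm (x - u)\<close>; the triangle
  inequality then doubles the distance. This is the source of the factor 2 in both the
  \<open>2 * \<epsilon>\<close> bounds and the constant \<open>d / 2\<close>.\<close>

lemma norm_sgn_diff_le:
  fixes x u :: "'a::real_normed_vector"
  assumes "norm u = 1" and "x \<noteq> 0"
  shows "norm (sgn x - u) \<le> 2 * norm (x - u)"
proof -
  have "sgn x - x = (1 - norm x) *\<^sub>R sgn x"
    using assms by (simp add: sgn_div_norm algebra_simps)
  then have "norm (sgn x - x) = \<bar>norm u - norm x\<bar>"
    using assms by (simp add: norm_sgn)
  also have "\<dots> \<le> norm (x - u)"
    using norm_triangle_ineq3[of u x] by (simp add: norm_minus_commute)
  finally show ?thesis
    using norm_triangle_ineq[of "sgn x - x" "x - u"] by simp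
qed

section \<open>Norm-bases of cones: compactness and the gap they induce\<close>

lemma proper_cone_imp_cone: "proper_cone C \<Longrightarrow> cone C"
  and proper_cone_zero: "proper_cone C \<Longrightarrow> 0 \<in> C"
  by (auto simp: proper_cone_def)

lemma sgn_in_norm_base:
  assumes "cone C" and "x \<in> C" and "x \<noteq> 0"
  shows "sgn x \<in> norm_base C"
  using assms by (auto simp: norm_base_def norm_sgn sgn_div_norm intro: mem_cone)

lemma norm_base_nonempty:
  assumes "proper_cone C"
  shows "norm_base C \<noteq> {}"
  using assms sgn_in_norm_base by (fastforce simp: proper_cone_def)

text \<open>Only compactness near the origin enters: the points of \<open>L\<close> of norm
  \<open>r\<close> form a closed part of the compact set \<open>L \<inter> cball 0 r\<close>, and
  scaling by \<open>1 / r\<close> turns them into the norm-base.\<close>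

lemma compact_norm_base:
  fixes L :: "'a::real_normed_vector set"
  assumes "locally_compact_cone L"
  shows "compact (norm_base L)"
proof -
  have L: "proper_cone L"
    using assms by (simp add: locally_compact_cone_def)
  then obtain r where r: "r > 0" "compact (L \<inter> cball 0 r)"
    using assms by (auto simp: locally_compact_cone_def dest: proper_cone_zero)
  have "norm_base L = (*\<^sub>R) (1 / r) ` (L \<inter> cball 0 r \<inter> sphere 0 r)" (is "_ = ?R")
  proof
    show "norm_base L \<subseteq> ?R"
    proof
      fix x assume x: "x \<in> norm_base L"
      then have "r *\<^sub>R x \<in> L \<inter> cball 0 r \<inter> sphere 0 r"
        using L r by (auto simp: norm_base_def intro: mem_cone proper_cone_imp_cone)
      moreover have "x = (1 / r) *\<^sub>R (r *\<^sub>R x)"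
        using r by simp
      ultimately show "x \<in> ?R" by blast
    qed
    show "?R \<subseteq> norm_base L"
      using mem_cone[OF proper_cone_imp_cone[OF L], of _ "1 / r"] r
      by (auto simp: norm_base_def)
  qed
  moreover have "closed (sphere (0::'a) r)"
    unfolding sphere_def by (intro closed_Collect_eq continuous_intros)
  ultimately show ?thesis
    using compact_scaling[OF compact_Int_closed[OF r(2)]] by simp
qed

text \<open>By homogeneity \<open>l\<close> may be taken on the unit sphere; normalising the point
  of \<open>K\<close> as well then costs a factor 2. The gap between the bases thus becomes a gap
  between the cones that grows linearly, which is what bounds \<open>\<Phi>\<close> away from
  zero.\<close>

lemma setdist_norm_base_le:
  assumes "cone L" and "proper_cone K" and "l \<in> L" and "k \<in> K"
  shows "setdist (norm_base L) (norm_base K) / 2 * norm l \<le> norm (l - k)"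
proof (cases "l = 0")
  case False
  define d where "d = setdist (norm_base L) (norm_base K)"
  have l: "sgn l \<in> norm_base L"
    using assms False by (simp add: sgn_in_norm_base)
  define k' where "k' = k /\<^sub>R norm l"
  have k': "k' \<in> K"
    using assms unfolding k'_def by (intro mem_cone proper_cone_imp_cone) auto
  have "d \<le> 2 * norm (k' - sgn l)"
  proof (cases "k' = 0")
    case True
    \<comment> \<open>The origin has no direction to normalise, so any base point of
      \<open>K\<close> serves: two unit vectors are at distance at most 2, which is
      \<open>2 * norm (sgn l)\<close>.\<close>
    obtain b where b: "b \<in> norm_base K"
      using norm_base_nonempty assms by blast
    have "d \<le> dist (sgn l) b"
      unfolding d_def using l b by (rule setdist_le_dist)
    also have "\<dots> \<le> norm (sgn l) + norm b"
      by (simp add: dist_norm norm_triangle_ineq4)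
    finally show ?thesis
      using True False b by (simp add: norm_sgn norm_base_def)
  next
    case k0: False
    have "d \<le> dist (sgn l) (sgn k')"
      unfolding d_def using l sgn_in_norm_base[OF proper_cone_imp_cone[OF assms(2)] k' k0]
      by (rule setdist_le_dist)
    also have "\<dots> \<le> 2 * norm (k' - sgn l)"
      using norm_sgn_diff_le[of "sgn l" k'] False k0
      by (simp add: norm_sgn dist_norm norm_minus_commute)
    finally show ?thesis .
  qed
  moreover have "l - k = norm l *\<^sub>R (sgn l - k')"
    using False by (simp add: k'_def sgn_div_norm algebra_simps)
  then have "norm (l - k) = norm l * norm (k' - sgn l)"
    by (simp add: norm_minus_commute)
  ultimately show ?thesis
    using mult_left_mono[of d "2 * norm (k' - sgn l)" "norm l"]
    by (simp add: d_def mult.commute mult.left_commute)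
qed simp

section \<open>Homogeneity of the distance to a cone\<close>

lemma infdist_scaleR_cone:
  fixes C :: "'a::real_normed_vector set"
  assumes "cone C" and "C \<noteq> {}" and "t \<ge> 0"
  shows "infdist (t *\<^sub>R x) C = t * infdist x C"
proof -
  \<comment> \<open>One inequality suffices: the reverse one is the same statement with factor
    \<open>1 / t\<close> at the point \<open>t *\<^sub>R x\<close>.\<close>
  have le: "infdist (s *\<^sub>R y) C \<le> s * infdist y C" if "s > 0" for s and y :: 'a
  proof -
    have "infdist (s *\<^sub>R y) C / s \<le> dist y a" if "a \<in> C" for a
    proof -
      have "s *\<^sub>R a \<in> C"
        using assms \<open>s > 0\<close> that by (simp add: mem_cone)
      then have "infdist (s *\<^sub>R y) C \<le> dist (s *\<^sub>R y) (s *\<^sub>R a)"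
        by (rule infdist_le)
      also have "\<dots> = s * dist y a"
        using \<open>s > 0\<close> by (simp add: dist_norm flip: scaleR_diff_right)
      finally show ?thesis
        using \<open>s > 0\<close> by (simp add: field_simps)
    qed
    then have "infdist (s *\<^sub>R y) C / s \<le> infdist y C"
      unfolding infdist_notempty[OF assms(2), of y] by (intro cINF_greatest assms)
    then show ?thesis
      using \<open>s > 0\<close> by (simp add: field_simps)
  qed
  show ?thesis
  proof (cases "t = 0")
    case True
    then show ?thesis
      using assms by (simp add: cone_contains_0)
  next
    case False
    with assms have t: "t > 0" by simp
    have "infdist x C \<le> (1 / t) * infdist (t *\<^sub>R x) C"
      using le[of "1 / t" "t *\<^sub>R x"] t by simp
    then show ?thesis
      using le[OF t, of x] t by (simp add: field_simps)
  qed
qed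

section \<open>Finite covers by members of the family\<close>

lemma cone_interior_scaleR:
  fixes C :: "'a::real_normed_vector set"
  assumes "cone C" and "x \<in> interior C" and "t > 0"
  shows "t *\<^sub>R x \<in> interior C"
proof (rule interiorI)
  show "open ((*\<^sub>R) t ` interior C)"
    using assms by (simp add: open_scaling)
  show "t *\<^sub>R x \<in> (*\<^sub>R) t ` interior C"
    using assms by blast
  show "(*\<^sub>R) t ` interior C \<subseteq> C"
    using assms interior_subset by (auto intro!: mem_cone)
qed

text \<open>A unit vector on the ray through a point \<open>a\<close> of the ball is
  \<open>sgn a\<close>, so the estimate for radial projection applies to \<open>a\<close>.\<close>

lemma cone_gen_cball_unit_dist:
  assumes "x \<in> cone_gen (cball u e)" and "norm x = 1" and "norm u = 1"
  shows "dist x u \<le> 2 * e"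
proof -
  obtain t a where ta: "x = t *\<^sub>R a" "t \<ge> 0" "dist u a \<le> e"
    using assms by (auto simp: cone_gen_def)
  have "a \<noteq> 0" and "t > 0"
    using ta assms by (auto simp: order_le_less)
  moreover have "sgn x = x"
    using assms by (simp add: sgn_div_norm)
  ultimately have "sgn a = x"
    using ta by (simp add: sgn_scaleR)
  then show ?thesis
    using norm_sgn_diff_le[OF assms(3) \<open>a \<noteq> 0\<close>] ta
    by (simp add: dist_norm norm_minus_commute)
qed

text \<open>A finite subcover of the compact norm-base extends along rays to all of
  \<open>L\<close>. The last claim yields an actual base point rather than a bound on an infimum, so
  that base points of two cones can be compared by the triangle inequality.\<close>

lemma directionally_fine_finite_cover:
  fixes L :: "'a::real_normed_vector set"
  assumes F: "directionally_fine F" and L: "locally_compact_cone L" and e: "0 < e" "e < 1"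
  obtains D where "cone D" "closed D" "finite_union_of_members F D"
    "L - {0} \<subseteq> interior D" "L \<subseteq> D" "D \<subseteq> cone_enlargement L e"
    "\<And>x. x \<in> D \<Longrightarrow> norm x = 1 \<Longrightarrow> \<exists>u\<in>norm_base L. dist x u \<le> 2 * e"
proof -
  have pL: "proper_cone L"
    using L by (simp add: locally_compact_cone_def)
  have mem: "proper_cone C" "closed C" if "C \<in> F" for C
    using F that by (auto simp: directionally_fine_def)
  have "\<exists>C\<in>F. u \<in> interior C \<and> C \<subseteq> cone_gen (cball u e)" if "u \<in> norm_base L" for u
  proof -
    have "u \<in> sphere 0 1" and "e \<in> {0<..<1}"
      using that e by (auto simp: norm_base_def)
    then show ?thesis
      using F unfolding directionally_fine_def by blast
  qed
  then obtain c where c: "\<And>u. u \<in> norm_base L \<Longrightarrow>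
      c u \<in> F \<and> u \<in> interior (c u) \<and> c u \<subseteq> cone_gen (cball u e)"
    by metis
  obtain T where T: "T \<subseteq> norm_base L" "finite T" "norm_base L \<subseteq> (\<Union>u\<in>T. interior (c u))"
    by (rule compactE_image[OF compact_norm_base[OF L], of "norm_base L" "\<lambda>u. interior (c u)"])
      (use c in blast)+
  define D where "D = \<Union>(c ` T)"
  have cF: "c u \<in> F" and cn: "cone (c u)" if "u \<in> T" for u
    using T c that mem(1) proper_cone_imp_cone by blast+
  show ?thesis
  proof
    show "cone D"
      using cn unfolding D_def by (auto simp: cone_def)
    show "closed D"
      unfolding D_def using T cF mem by auto
    show "finite_union_of_members F D"
      unfolding finite_union_of_members_def D_def using T cF by blast
    show int: "L - {0} \<subseteq> interior D"
    proof
      fix x assume x: "x \<in> L - {0}"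
      then have "sgn x \<in> norm_base L"
        using pL by (simp add: sgn_in_norm_base proper_cone_imp_cone)
      then obtain u where u: "u \<in> T" "sgn x \<in> interior (c u)"
        using T by auto
      have "norm x *\<^sub>R sgn x \<in> interior (c u)"
        using cn u x by (intro cone_interior_scaleR) auto
      then have "x \<in> interior (c u)"
        using x by (simp add: sgn_div_norm)
      then show "x \<in> interior D"
        using u interior_mono[of "c u" D] unfolding D_def by blast
    qed
    \<comment> \<open>The interiors account only for nonzero points. The origin lies in every member
      of the family, hence in the union once that union has at least one member.\<close>
    have "T \<noteq> {}"
      using T norm_base_nonempty[OF pL] by auto
    then have "0 \<in> D"
      using cF mem(1) proper_cone_zero unfolding D_def by blast
    then show "L \<subseteq> D"
      using int interior_subset by blast
    show "D \<subseteq> cone_enlargement L e"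
    proof
      fix x assume "x \<in> D"
      then obtain u where u: "u \<in> norm_base L" "x \<in> cone_gen (cball u e)"
        using T c unfolding D_def by blast
      then obtain t a where ta: "x = t *\<^sub>R a" "t \<ge> 0" "dist u a \<le> e"
        by (auto simp: cone_gen_def)
      \<comment> \<open>The ball around \<open>u\<close> is rewritten as \<open>u\<close> plus
        \<open>e\<close> times the unit ball, the form used in
        \<open>cone_enlargement\<close>.\<close>
      have "a = u + e *\<^sub>R ((a - u) /\<^sub>R e)"
        using e by simp
      moreover have "(a - u) /\<^sub>R e \<in> cball 0 1"
        using ta e by (simp add: dist_norm norm_minus_commute pos_divide_le_eq
            flip: divide_inverse_commute)
      ultimately show "x \<in> cone_enlargement L e"
        unfolding cone_enlargement_def cone_gen_def using ta u by blast
    qed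
    show "\<exists>u\<in>norm_base L. dist x u \<le> 2 * e" if x: "x \<in> D" "norm x = 1" for x
    proof -
      obtain u where "u \<in> norm_base L" "x \<in> cone_gen (cball u e)"
        using x T c unfolding D_def by blast
      then show ?thesis
        using cone_gen_cball_unit_dist x by (force simp: norm_base_def)
    qed
  qed
qed

section \<open>The separating cones and the separating function\<close>

theorem theorem3p25:
  fixes F :: "'a::real_normed_vector set set" and L K :: "'a set"
  assumes "directionally_fine F"
    and "locally_compact_cone L" and "locally_compact_cone K"
    and "L \<inter> K = {0}"
  shows "setdist (norm_base L) (norm_base K) > 0 \<and>
    (\<forall>\<epsilon>. 0 < \<epsilon> \<and> \<epsilon> < min 1 (setdist (norm_base L) (norm_base K) / 4) \<longrightarrow>
      (\<exists>D\<^sub>L D\<^sub>K.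
        proper_cone D\<^sub>L \<and> closed D\<^sub>L \<and> finite_union_of_members F D\<^sub>L \<and>
        proper_cone D\<^sub>K \<and> closed D\<^sub>K \<and> finite_union_of_members F D\<^sub>K \<and>
        L - {0} \<subseteq> interior D\<^sub>L \<and> K - {0} \<subseteq> interior D\<^sub>K \<and> D\<^sub>L \<inter> D\<^sub>K = {0} \<and>
        L \<subseteq> D\<^sub>L \<and> D\<^sub>L \<subseteq> cone_enlargement L \<epsilon> \<and>
        K \<subseteq> D\<^sub>K \<and> D\<^sub>K \<subseteq> cone_enlargement K \<epsilon> \<and>
        D\<^sub>L \<inter> sphere 0 1 \<subseteq> {x \<in> sphere 0 1. infdist x (norm_base L) \<le> 2 * \<epsilon>} \<and>
        D\<^sub>K \<inter> sphere 0 1 \<subseteq> {x \<in> sphere 0 1. infdist x (norm_base K) \<le> 2 * \<epsilon>})) \<and>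
    (\<exists>(\<Phi> :: 'a \<Rightarrow> real) \<gamma>\<^sub>L \<gamma>\<^sub>K.
      continuous_on UNIV \<Phi> \<and> positively_homogeneous \<Phi> \<and> \<gamma>\<^sub>L > 0 \<and> \<gamma>\<^sub>K > 0 \<and>
      (\<forall>x. \<bar>\<Phi> x\<bar> \<le> norm x) \<and>
      (\<forall>l\<in>L. \<Phi> l \<ge> \<gamma>\<^sub>L * norm l) \<and>
      (\<forall>k\<in>K. \<Phi> k \<le> - \<gamma>\<^sub>K * norm k))"
proof (intro conjI allI impI)
  let ?d = "setdist (norm_base L) (norm_base K)"
  have pL: "proper_cone L" and pK: "proper_cone K"
    using assms by (auto simp: locally_compact_cone_def)
  note cL = proper_cone_imp_cone[OF pL] and cK = proper_cone_imp_cone[OF pK]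
  have disj: "norm_base L \<inter> norm_base K = {}"
  proof -
    have "norm_base L \<inter> norm_base K = L \<inter> K \<inter> sphere 0 1"
      unfolding norm_base_def by blast
    then show ?thesis
      by (simp add: assms(4))
  qed
  \<comment> \<open>Disjoint nonempty compact sets lie at positive distance.\<close>
  show d: "?d > 0"
    using disj assms(2,3) pL pK
    by (simp add: setdist_gt_0_compact_closed compact_norm_base compact_imp_closed
        norm_base_nonempty)

  show "\<exists>D\<^sub>L D\<^sub>K.
        proper_cone D\<^sub>L \<and> closed D\<^sub>L \<and> finite_union_of_members F D\<^sub>L \<and>
        proper_cone D\<^sub>K \<and> closed D\<^sub>K \<and> finite_union_of_members F D\<^sub>K \<and>
        L - {0} \<subseteq> interior D\<^sub>L \<and> K - {0} \<subseteq> interior D\<^sub>K \<and> D\<^sub>L \<inter> D\<^sub>K = {0} \<and>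
        L \<subseteq> D\<^sub>L \<and> D\<^sub>L \<subseteq> cone_enlargement L \<epsilon> \<and>
        K \<subseteq> D\<^sub>K \<and> D\<^sub>K \<subseteq> cone_enlargement K \<epsilon> \<and>
        D\<^sub>L \<inter> sphere 0 1 \<subseteq> {x \<in> sphere 0 1. infdist x (norm_base L) \<le> 2 * \<epsilon>} \<and>
        D\<^sub>K \<inter> sphere 0 1 \<subseteq> {x \<in> sphere 0 1. infdist x (norm_base K) \<le> 2 * \<epsilon>}"
    if "0 < \<epsilon> \<and> \<epsilon> < min 1 (?d / 4)" for \<epsilon>
  proof -
    have e: "0 < \<epsilon>" "\<epsilon> < 1" "4 * \<epsilon> < ?d"
      using that by auto
    obtain D\<^sub>L where DL: "cone D\<^sub>L" "closed D\<^sub>L" "finite_union_of_members F D\<^sub>L"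
      "L - {0} \<subseteq> interior D\<^sub>L" "L \<subseteq> D\<^sub>L" "D\<^sub>L \<subseteq> cone_enlargement L \<epsilon>"
      and nearL: "\<And>x. x \<in> D\<^sub>L \<Longrightarrow> norm x = 1 \<Longrightarrow> \<exists>u\<in>norm_base L. dist x u \<le> 2 * \<epsilon>"
      using directionally_fine_finite_cover[OF assms(1,2) e(1,2)] by blast
    obtain D\<^sub>K where DK: "cone D\<^sub>K" "closed D\<^sub>K" "finite_union_of_members F D\<^sub>K"
      "K - {0} \<subseteq> interior D\<^sub>K" "K \<subseteq> D\<^sub>K" "D\<^sub>K \<subseteq> cone_enlargement K \<epsilon>"
      and nearK: "\<And>x. x \<in> D\<^sub>K \<Longrightarrow> norm x = 1 \<Longrightarrow> \<exists>u\<in>norm_base K. dist x u \<le> 2 * \<epsilon>"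
      using directionally_fine_finite_cover[OF assms(1,3) e(1,2)] by blast
    have sub: "D\<^sub>L \<inter> D\<^sub>K \<subseteq> {0}"
    proof (rule ccontr)
      assume "\<not> D\<^sub>L \<inter> D\<^sub>K \<subseteq> {0}"
      then obtain x where x: "x \<in> D\<^sub>L" "x \<in> D\<^sub>K" "x \<noteq> 0"
        by blast
      \<comment> \<open>Both unions are cones, so a common nonzero point may be normalised. It is
        then within \<open>2 * \<epsilon>\<close> of each base, giving
        \<open>?d \<le> 4 * \<epsilon>\<close> against the choice of
        \<open>\<epsilon>\<close>.\<close>
      then have s: "sgn x \<in> D\<^sub>L" "sgn x \<in> D\<^sub>K" "norm (sgn x) = 1"
        using DL(1) DK(1) sgn_in_norm_base by (auto simp: norm_base_def norm_sgn)
      obtain u v where u: "u \<in> norm_base L" "dist (sgn x) u \<le> 2 * \<epsilon>"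
        and v: "v \<in> norm_base K" "dist (sgn x) v \<le> 2 * \<epsilon>"
        using nearL nearK s by meson
      have "?d \<le> dist u v"
        using u v by (simp add: setdist_le_dist)
      then show False
        using u v e dist_triangle3[of u v "sgn x"] by linarith
    qed
    then have int: "D\<^sub>L \<inter> D\<^sub>K = {0}"
      using DL(5) DK(5) pL pK proper_cone_zero by blast
    \<comment> \<open>Nonzero witnesses for properness: \<open>l\<close> makes
      \<open>D\<^sub>L\<close> nontrivial, and \<open>k\<close>, lying in \<open>D\<^sub>K\<close>,
      cannot lie in \<open>D\<^sub>L\<close>; symmetrically for \<open>D\<^sub>K\<close>.\<close>
    obtain l k where lk: "l \<in> L" "l \<noteq> 0" "k \<in> K" "k \<noteq> 0"
      using pL pK unfolding proper_cone_def by blast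
    have "proper_cone D\<^sub>L" "proper_cone D\<^sub>K"
      using DL(1,5) DK(1,5) int lk unfolding proper_cone_def by blast+
    moreover have "infdist x (norm_base L) \<le> 2 * \<epsilon>" if "x \<in> D\<^sub>L" "norm x = 1" for x
      using nearL[OF that] infdist_le2 by blast
    moreover have "infdist x (norm_base K) \<le> 2 * \<epsilon>" if "x \<in> D\<^sub>K" "norm x = 1" for x
      using nearK[OF that] infdist_le2 by blast
    ultimately show ?thesis
      using DL DK int by (intro exI[of _ D\<^sub>L] exI[of _ D\<^sub>K]) auto
  qed

  \<comment> \<open>On each of the two cones one of the distances vanishes, so only the distance to
    the other cone has to be estimated there.\<close>
  define \<Phi> where "\<Phi> x = infdist x K - infdist x L" for x
  have ne: "L \<noteq> {}" "K \<noteq> {}"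
    using assms(4) by auto
  \<comment> \<open>Both distances lie between 0 and \<open>norm x\<close> because each cone
    contains the origin, so their difference is at most \<open>norm x\<close> in absolute
    value.\<close>
  have bound: "0 \<le> infdist x C \<and> infdist x C \<le> norm x" if "proper_cone C" for x and C :: "'a set"
    using infdist_le[OF proper_cone_zero[OF that], of x] by (simp add: infdist_nonneg)
  have "continuous_on UNIV \<Phi>"
    unfolding \<Phi>_def by (intro continuous_intros)
  moreover have "positively_homogeneous \<Phi>"
    using cL cK ne
    by (simp add: positively_homogeneous_def \<Phi>_def infdist_scaleR_cone algebra_simps)
  moreover have "\<bar>\<Phi> x\<bar> \<le> norm x" for x
    using bound[OF pL, of x] bound[OF pK, of x] unfolding \<Phi>_def by linarith
  moreover have "\<Phi> l \<ge> ?d / 2 * norm l" if "l \<in> L" for l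
  proof -
    have "?d / 2 * norm l \<le> infdist l K"
      unfolding infdist_notempty[OF ne(2)] dist_norm
      using setdist_norm_base_le[OF cL pK that] ne by (intro cINF_greatest)
    then show ?thesis
      using that by (simp add: \<Phi>_def)
  qed
  moreover have "\<Phi> k \<le> - (?d / 2) * norm k" if "k \<in> K" for k
  proof -
    have "?d / 2 * norm k \<le> infdist k L"
      unfolding infdist_notempty[OF ne(1)] dist_norm setdist_sym[of "norm_base L"]
      using setdist_norm_base_le[OF cK pL that] ne by (intro cINF_greatest)
    then show ?thesis
      using that by (simp add: \<Phi>_def)
  qed
  ultimately show "\<exists>(\<Phi> :: 'a \<Rightarrow> real) \<gamma>\<^sub>L \<gamma>\<^sub>K.
      continuous_on UNIV \<Phi> \<and> positively_homogeneous \<Phi> \<and> \<gamma>\<^sub>L > 0 \<and> \<gamma>\<^sub>K > 0 \<and>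
      (\<forall>x. \<bar>\<Phi> x\<bar> \<le> norm x) \<and>
      (\<forall>l\<in>L. \<Phi> l \<ge> \<gamma>\<^sub>L * norm l) \<and>
      (\<forall>k\<in>K. \<Phi> k \<le> - \<gamma>\<^sub>K * norm k)"
    using d by (intro exI[of _ \<Phi>] exI[of _ "?d / 2"]) auto
qed

end
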